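(* Let $n$, $r$ and $s$ be non-negative integers with $n\geq r\geq s$. If $s$ is odd, then \[ \sum_{j=1}^{\lfloor n/2\rfloor}\binom{n-r}{2j-s}5^jj=2^{n-r-3}5^{\frac{s+1}{2}}\big((n-r)L_{n-r-1}+2sF_{n-r}\big), \] \[ \sum_{j=1}^{\lfloor n/2\rfloor}\binom{n-r}{2j+1-s}5^jj=2^{n-r-3}5^{\frac{s-1}{2}}\big(5(n-r)F_{n-r-1}+2(s-1)L_{n-r}\big), \] while if $s$ is even, then \[ \sum_{j=1}^{\lfloor n/2\rfloor}\binom{n-r}{2j-s}5^jj=2^{n-r-3}5^{\frac{s}{2}}\big(5(n-r)F_{n-r-1}+2sL_{n-r}\big), \] \[ \sum_{j=1}^{\lfloor n/2\rfloor}\binom{n-r}{2j+1-s}5^jj=2^{n-r-3}5^{\frac{s}{2}}\big((n-r)L_{n-r-1}+2(s-1)F_{n-r}\big). \]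
   Context: $F_n$ and $L_n$ are the Fibonacci and Lucas numbers ($F_0=0,F_1=1$, $L_0=2,L_1=1$, $X_n=X_{n-1}+X_{n-2}$), extended to negative indices by $F_{-n}=(-1)^{n-1}F_n$, $L_{-n}=(-1)^nL_n$. $\lfloor x\rfloor$ is the floor function; binomial coefficients $\binom{N}{i}$ are $0$ when $i<0$ or $i>N$. *)

theory Defs
  imports Complex_Main "HOL-Number_Theory.Fib"
begin

fun lucas :: "nat \<Rightarrow> nat" where
  "lucas 0 = 2"
| "lucas (Suc 0) = 1"
| "lucas (Suc (Suc n)) = lucas (Suc n) + lucas n"

(* Extension to all integers: F_{-m} = (-1)^(m-1) F_m and L_{-m} = (-1)^m L_m for m > 0.
   The truncated subtraction is only used for m > 0. *)

definition fib_int :: "int \<Rightarrow> int" where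
  "fib_int k = (if 0 \<le> k then int (fib (nat k))
     else (-1) ^ (nat (-k) - 1) * int (fib (nat (-k))))"

definition lucas_int :: "int \<Rightarrow> int" where
  "lucas_int k = (if 0 \<le> k then int (lucas (nat k))
     else (-1) ^ nat (-k) * int (lucas (nat (-k))))"

(* The lower index is an integer: 2 j - s may be negative, and must not be truncated to 0. *)
definition binom :: "nat \<Rightarrow> int \<Rightarrow> nat" where
  "binom N i = (if i < 0 then 0 else N choose nat i)"

end

theory Submission
  imports Defs
begin

text \<open>
  Substituting \<open>k = j - u\<close>, where the shift in the lower index is \<open>2u\<close> or \<open>2u - 1\<close>,
  reduces all four identities to the sums of \<open>(N choose 2k) 5^k (k + u)\<close> and of
  \<open>(N choose 2k + 1) 5^k (k + u)\<close>. The unweighted sums are half of \<open>2^N L_N\<close> and \<open>2^N F_N\<close>, as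
  \<open>(1 + sqrt 5)^N = 2^(N - 1) (L_N + F_N sqrt 5)\<close>, and the factor \<open>k\<close> is absorbed by
  \<open>i (N choose i) = N (N - 1 choose i - 1)\<close>.
\<close>

text \<open>With \<open>double_lucas_Suc\<close>, these are the two coordinates of (1 + sqrt 5)(L_m
  + F_m sqrt 5) = 2 (L_(m+1) + F_(m+1) sqrt 5).\<close>

lemma double_fib_Suc: "2 * fib (Suc m) = fib m + lucas m"
  by (induction m rule: lucas.induct) auto

lemma double_lucas_Suc: "2 * lucas (Suc m) = 5 * fib m + lucas m"
  by (induction m rule: lucas.induct) auto

text \<open>The sums are the coordinates of (1 + sqrt 5)^m in the basis 1, sqrt 5. Pascal's rule
  expresses each one at \<open>Suc m\<close> through both at \<open>m\<close>, hence the joint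
  induction. The bounds on \<open>K\<close> ensure that no nonzero binomial is cut off.\<close>

lemma sum_choose_even_odd:
  "m < 2 * K \<Longrightarrow> 2 * (\<Sum>k<K. real (m choose (2 * k)) * 5 ^ k) = 2 ^ m * real (lucas m)"
  "m \<le> 2 * K \<Longrightarrow> 2 * (\<Sum>k<K. real (m choose Suc (2 * k)) * 5 ^ k) = 2 ^ m * real (fib m)"
proof (induction m arbitrary: K)
  case 0
  {
    case 1
    then obtain K' where "K = Suc K'"
      by (cases K) auto
    then show ?case
      by (simp add: sum.lessThan_Suc_shift del: sum.lessThan_Suc)
  next
    case 2
    show ?case
      by simp
  }
next
  case (Suc m)
  {
    case 1
    \<comment> \<open>Pascal's rule splits the index 2k + 2 into 2k + 2 and 2k + 1. The odd part
      starts one step later, so it has \<open>K'\<close> terms and an extra factor 5.\<close>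
    then obtain K' where K: "K = Suc K'" and m: "m \<le> 2 * K'"
      by (cases K) auto
    have "(\<Sum>k<K. real (Suc m choose (2 * k)) * 5 ^ k)
        = (\<Sum>k<K. real (m choose (2 * k)) * 5 ^ k)
          + 5 * (\<Sum>k<K'. real (m choose Suc (2 * k)) * 5 ^ k)"
      unfolding K sum.lessThan_Suc_shift
      by (simp add: sum.distrib sum_distrib_left algebra_simps)
    moreover have "2 ^ Suc m * real (lucas (Suc m)) = 5 * (2 ^ m * real (fib m)) + 2 ^ m * real (lucas m)"
      using arg_cong[OF double_lucas_Suc[of m], of "\<lambda>x. 2 ^ m * real x"]
      by (simp add: algebra_simps)
    ultimately show ?case
      using Suc.IH(1)[of K] Suc.IH(2)[of K'] 1 m by simp
  next
    case 2
    have "(\<Sum>k<K. real (Suc m choose Suc (2 * k)) * 5 ^ k)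
        = (\<Sum>k<K. real (m choose (2 * k)) * 5 ^ k) + (\<Sum>k<K. real (m choose Suc (2 * k)) * 5 ^ k)"
      by (simp add: sum.distrib algebra_simps)
    moreover have "2 ^ Suc m * real (fib (Suc m)) = 2 ^ m * real (fib m) + 2 ^ m * real (lucas m)"
      using arg_cong[OF double_fib_Suc[of m], of "\<lambda>x. 2 ^ m * real x"]
      by (simp add: algebra_simps)
    ultimately show ?case
      using Suc.IH(1)[of K] Suc.IH(2)[of K] 2 by simp
  }
qed

lemma sum_weighted_choose_even:
  assumes "m < 2 * K"
  shows "(\<Sum>k<K. real (m choose (2 * k)) * 5 ^ k * real (k + u))
    = 2 powi (int m - 3) * (5 * real m * real_of_int (fib_int (int m - 1))
        + 4 * real u * real_of_int (lucas_int (int m)))"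
proof -
  have weight: "2 * (\<Sum>k<K. real (m choose (2 * k)) * 5 ^ k * real k)
      = 2 powi (int m - 2) * (5 * real m * real_of_int (fib_int (int m - 1)))"
  proof (cases m)
    \<comment> \<open>Here the Fibonacci index is -1, but its factor \<open>m\<close> vanishes; on
      the left only k = 0 has a nonzero binomial, and its weight is 0.\<close>
    case 0
    then have "(\<Sum>k<K. real (m choose (2 * k)) * 5 ^ k * real k) = 0"
      by (intro sum.neutral) auto
    with 0 show ?thesis
      by simp
  next
    case (Suc m')
    with assms obtain K' where K: "K = Suc K'" and m': "m' \<le> 2 * K'"
      by (cases K) auto
    \<comment> \<open>The factor 2 turns the weight k + 1 into the lower index 2k + 2, which
      absorption requires.\<close>
    have absorb: "2 * (real (m choose (2 * Suc k)) * real (Suc k))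
        = real m * real (m' choose Suc (2 * k))" for k
      using arg_cong[OF Suc_times_binomial[of "Suc (2 * k)" m'], of real]
      unfolding Suc by (simp add: algebra_simps)
    have "2 * (\<Sum>k<K. real (m choose (2 * k)) * 5 ^ k * real k)
        = (\<Sum>k<K'. 5 * 5 ^ k * (2 * (real (m choose (2 * Suc k)) * real (Suc k))))"
      unfolding K sum.lessThan_Suc_shift by (simp add: sum_distrib_left mult_ac)
    also have "\<dots> = 5 * real m * (\<Sum>k<K'. real (m' choose Suc (2 * k)) * 5 ^ k)"
      unfolding absorb by (simp add: sum_distrib_left mult_ac)
    finally show ?thesis
      using sum_choose_even_odd(2)[OF m'] Suc
      by (simp add: fib_int_def power_int_diff)
  qed
  have "2 * (\<Sum>k<K. real (m choose (2 * k)) * 5 ^ k * real (k + u))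
      = 2 * (\<Sum>k<K. real (m choose (2 * k)) * 5 ^ k * real k)
        + real u * (2 * (\<Sum>k<K. real (m choose (2 * k)) * 5 ^ k))"
    by (simp add: sum.distrib sum_distrib_left algebra_simps)
  then show ?thesis
    unfolding weight sum_choose_even_odd(1)[OF assms]
    by (simp add: lucas_int_def power_int_diff algebra_simps)
qed

lemma sum_weighted_choose_odd:
  assumes "m \<le> 2 * K"
  shows "(\<Sum>k<K. real (m choose Suc (2 * k)) * 5 ^ k * real (k + u))
    = 2 powi (int m - 3) * (real m * real_of_int (lucas_int (int m - 1))
        + 2 * (2 * real u - 1) * real_of_int (fib_int (int m)))"
proof -
  \<comment> \<open>Absorption applies to the weight 2k + 1, and 2(k + u) = (2k + 1) + (2u - 1). The
    second summand is taken in the reals, since it is -1 for u = 0.\<close>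
  have weight: "(\<Sum>k<K. real (m choose Suc (2 * k)) * 5 ^ k * real (Suc (2 * k)))
      = 2 powi (int m - 2) * (real m * real_of_int (lucas_int (int m - 1)))"
  proof (cases m)
    case 0
    then show ?thesis
      by simp
  next
    case (Suc m')
    with assms have m': "m' < 2 * K"
      by simp
    have absorb: "real (m choose Suc (2 * k)) * real (Suc (2 * k))
        = real m * real (m' choose (2 * k))" for k
      using arg_cong[OF Suc_times_binomial[of "2 * k" m'], of real]
      unfolding Suc by (simp add: algebra_simps)
    have "(\<Sum>k<K. real (m choose Suc (2 * k)) * 5 ^ k * real (Suc (2 * k)))
        = (\<Sum>k<K. 5 ^ k * (real (m choose Suc (2 * k)) * real (Suc (2 * k))))"
      by (simp only: mult_ac)
    also have "\<dots> = real m * (\<Sum>k<K. real (m' choose (2 * k)) * 5 ^ k)"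
      unfolding absorb by (simp add: sum_distrib_left mult_ac)
    finally show ?thesis
      using sum_choose_even_odd(1)[OF m'] Suc
      by (simp add: lucas_int_def power_int_diff)
  qed
  have "2 * (\<Sum>k<K. real (m choose Suc (2 * k)) * 5 ^ k * real (k + u))
      = (\<Sum>k<K. real (m choose Suc (2 * k)) * 5 ^ k * real (Suc (2 * k))
          + (2 * real u - 1) * (real (m choose Suc (2 * k)) * 5 ^ k))"
    unfolding sum_distrib_left by (intro sum.cong) (simp_all add: algebra_simps)
  also have "\<dots> = (\<Sum>k<K. real (m choose Suc (2 * k)) * 5 ^ k * real (Suc (2 * k)))
        + (2 * real u - 1) * (\<Sum>k<K. real (m choose Suc (2 * k)) * 5 ^ k)"
    by (simp only: sum.distrib sum_distrib_left)
  also have "(\<Sum>k<K. real (m choose Suc (2 * k)) * 5 ^ k) = 2 ^ m * real (fib m) / 2"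
    using sum_choose_even_odd(2)[OF assms] by simp
  finally show ?thesis
    unfolding weight by (simp add: fib_int_def power_int_diff field_simps)
qed

text \<open>Terms with \<open>j < u\<close> will vanish because their lower index is negative. The
  assumption \<open>f 0 = 0\<close> covers u = 0, where the shifted range starts at 0 instead of
  1.\<close>

lemma sum_shift_from:
  fixes f g :: "nat \<Rightarrow> real"
  assumes "\<And>j. j < u \<Longrightarrow> f j = 0" and "f 0 = 0" and "\<And>k. f (k + u) = g k"
  shows "(\<Sum>j = 1..N. f j) = (\<Sum>k<Suc N - u. g k)"
proof -
  have "(\<Sum>j = 1..N. f j) = (\<Sum>j = u..<Suc N. f j)"
  proof (rule sum.mono_neutral_cong)
    fix j
    assume "j \<in> {u..<Suc N} - {1..N}"
    then show "f j = 0"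
      using assms(2) by (cases j) auto
  qed (use assms(1) in auto)
  also have "\<dots> = (\<Sum>k<Suc N - u. g k)"
    using assms(3)
    by (intro sum.reindex_bij_witness[of _ "\<lambda>k. k + u" "\<lambda>j. j - u"]) (auto, metis le_add_diff_inverse2)
  finally show ?thesis .
qed

text \<open>Substituting j = k + u takes out \<open>5 ^ u\<close> and leaves K =
  \<open>Suc N - u\<close> terms; the assumption is the bound m < 2K of
  \<open>sum_weighted_choose_even\<close>.\<close>

lemma sum_binom_even_shift:
  assumes "m + 2 * u < 2 * Suc N"
  shows "(\<Sum>j = 1..N. real (binom m (2 * int j - 2 * int u)) * 5 ^ j * real j)
    = 2 powi (int m - 3) * 5 ^ u * (5 * real m * real_of_int (fib_int (int m - 1))
        + 4 * real u * real_of_int (lucas_int (int m)))"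
proof -
  have "(\<Sum>j = 1..N. real (binom m (2 * int j - 2 * int u)) * 5 ^ j * real j)
      = (\<Sum>k<Suc N - u. 5 ^ u * (real (m choose (2 * k)) * 5 ^ k * real (k + u)))"
    by (rule sum_shift_from) (auto simp: binom_def power_add nat_mult_distrib)
  also have "\<dots> = 5 ^ u * (\<Sum>k<Suc N - u. real (m choose (2 * k)) * 5 ^ k * real (k + u))"
    by (simp only: sum_distrib_left)
  also have "\<dots> = 5 ^ u * (2 powi (int m - 3) * (5 * real m * real_of_int (fib_int (int m - 1))
        + 4 * real u * real_of_int (lucas_int (int m))))"
    using assms by (subst sum_weighted_choose_even) auto
  finally show ?thesis
    by (simp only: mult_ac)
qed

lemma sum_binom_odd_shift:
  assumes "m + 2 * u \<le> 2 * Suc N"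
  shows "(\<Sum>j = 1..N. real (binom m (2 * int j + 1 - 2 * int u)) * 5 ^ j * real j)
    = 2 powi (int m - 3) * 5 ^ u * (real m * real_of_int (lucas_int (int m - 1))
        + 2 * (2 * real u - 1) * real_of_int (fib_int (int m)))"
proof -
  have "(\<Sum>j = 1..N. real (binom m (2 * int j + 1 - 2 * int u)) * 5 ^ j * real j)
      = (\<Sum>k<Suc N - u. 5 ^ u * (real (m choose Suc (2 * k)) * 5 ^ k * real (k + u)))"
    by (rule sum_shift_from)
      (auto simp: binom_def power_add nat_mult_distrib nat_add_distrib simp flip: Suc_eq_plus1)
  also have "\<dots> = 5 ^ u * (\<Sum>k<Suc N - u. real (m choose Suc (2 * k)) * 5 ^ k * real (k + u))"
    by (simp only: sum_distrib_left)
  also have "\<dots> = 5 ^ u * (2 powi (int m - 3) * (real m * real_of_int (lucas_int (int m - 1))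
        + 2 * (2 * real u - 1) * real_of_int (fib_int (int m))))"
    using assms by (subst sum_weighted_choose_odd) auto
  finally show ?thesis
    by (simp only: mult_ac)
qed

theorem theorem24:
  fixes n r s :: nat
  assumes "n \<ge> r" and "r \<ge> s"
  shows
    "(odd s \<longrightarrow>
       (\<Sum>j = 1..n div 2. real (binom (n - r) (2 * int j - int s)) * 5 ^ j * real j)
         = 2 powi (int n - int r - 3) * 5 ^ ((s + 1) div 2)
           * ((real n - real r) * real_of_int (lucas_int (int n - int r - 1))
              + 2 * real s * real_of_int (fib_int (int n - int r)))
     \<and> (\<Sum>j = 1..n div 2. real (binom (n - r) (2 * int j + 1 - int s)) * 5 ^ j * real j)
         = 2 powi (int n - int r - 3) * 5 ^ ((s - 1) div 2)
           * (5 * (real n - real r) * real_of_int (fib_int (int n - int r - 1))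
              + 2 * (real s - 1) * real_of_int (lucas_int (int n - int r))))
   \<and> (even s \<longrightarrow>
       (\<Sum>j = 1..n div 2. real (binom (n - r) (2 * int j - int s)) * 5 ^ j * real j)
         = 2 powi (int n - int r - 3) * 5 ^ (s div 2)
           * (5 * (real n - real r) * real_of_int (fib_int (int n - int r - 1))
              + 2 * real s * real_of_int (lucas_int (int n - int r)))
     \<and> (\<Sum>j = 1..n div 2. real (binom (n - r) (2 * int j + 1 - int s)) * 5 ^ j * real j)
         = 2 powi (int n - int r - 3) * 5 ^ (s div 2)
           * ((real n - real r) * real_of_int (lucas_int (int n - int r - 1))
              + 2 * (real s - 1) * real_of_int (fib_int (int n - int r))))"
proof -
  have m: "int (n - r) = int n - int r" "real (n - r) = real n - real r" "n - r + s \<le> n"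
    using assms by auto
  show ?thesis
  proof (cases "even s")
    case True
    then obtain u where u: "s = 2 * u"
      by blast
    have bounds: "n - r + 2 * u < 2 * Suc (n div 2)" "n - r + 2 * u \<le> 2 * Suc (n div 2)"
      using m(3) unfolding u by presburger+
    show ?thesis
      using sum_binom_even_shift[OF bounds(1)] sum_binom_odd_shift[OF bounds(2)] u
      by (simp add: m(1,2))
  next
    case False
    then obtain u where u: "s = 2 * u + 1"
      by (elim oddE)
    \<comment> \<open>For odd s the two sums swap roles: the first is an odd shift by u + 1, the
      second an even shift by u. The second bound is an equality when n is odd and r = s.\<close>
    have bounds: "n - r + 2 * u < 2 * Suc (n div 2)" "n - r + 2 * Suc u \<le> 2 * Suc (n div 2)"
      using m(3) unfolding u by presburger+
    have "2 * int j - int s = 2 * int j + 1 - 2 * int (Suc u)"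
      "2 * int j + 1 - int s = 2 * int j - 2 * int u" for j
      unfolding u by simp_all
    moreover have "(s + 1) div 2 = Suc u" "(s - 1) div 2 = u"
      "real s = 2 * real (Suc u) - 1" "real s - 1 = 2 * real u"
      unfolding u by simp_all
    ultimately show ?thesis
      using sum_binom_even_shift[OF bounds(1)] sum_binom_odd_shift[OF bounds(2)] False
      unfolding m(1,2) by (simp only:) simp
  qed
qed

end
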